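(* Let $\mathbb{F}_q$ be a finite field with $q\equiv 1\pmod 3$. Then there exist exactly $$\frac{q+12-(q \bmod 12)}{12}$$ isomorphism classes (over $\mathbb{F}_q$) of elliptic curves $E$ over $\mathbb{F}_q$ whose group $E(\mathbb{F}_q)[3]$ of rational $3$-torsion points is non-cyclic.
   Context: Here $q \bmod 12$ denotes the remainder in $\{0,\dots,11\}$ of the division of $q$ by $12$. *)

theory Defs
  imports Complex_Main "HOL-Algebra.Elementary_Groups" "HOL-Library.Cardinality"
begin

section \<open>Elliptic curves in Weierstrass form\<close>

text \<open>
  An elliptic curve over a field is given by a general Weierstrass equation
  \<open>y\<^sup>2 + a1 x y + a3 y = x\<^sup>3 + a2 x\<^sup>2 + a4 x + a6\<close> with nonzero discriminant. The five-coefficient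
  form is needed because characteristic 2 is allowed.
\<close>

datatype 'a weierstrass = Weierstrass 'a 'a 'a 'a 'a \<comment> \<open>\<open>a1\<close>, \<open>a2\<close>, \<open>a3\<close>, \<open>a4\<close>, \<open>a6\<close>\<close>

fun discriminant :: "'a::field weierstrass \<Rightarrow> 'a" where
  "discriminant (Weierstrass a1 a2 a3 a4 a6) =
    (let b2 = a1^2 + 4 * a2;
         b4 = 2 * a4 + a1 * a3;
         b6 = a3^2 + 4 * a6;
         b8 = a1^2 * a6 + 4 * a2 * a6 - a1 * a3 * a4 + a2 * a3^2 - a4^2
     in - (b2^2 * b8) - 8 * b4^3 - 27 * b6^2 + 9 * b2 * b4 * b6)"

definition elliptic_curve :: "'a::field weierstrass \<Rightarrow> bool" where
  "elliptic_curve E \<longleftrightarrow> discriminant E \<noteq> 0"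


section \<open>The group of rational points\<close>

datatype 'a point = Infinity | Affine 'a 'a

fun on_affine :: "'a::field weierstrass \<Rightarrow> 'a \<Rightarrow> 'a \<Rightarrow> bool" where
  "on_affine (Weierstrass a1 a2 a3 a4 a6) x y \<longleftrightarrow>
    y^2 + a1 * x * y + a3 * y = x^3 + a2 * x^2 + a4 * x + a6"

fun on_curve :: "'a::field weierstrass \<Rightarrow> 'a point \<Rightarrow> bool" where
  "on_curve E Infinity \<longleftrightarrow> True"
| "on_curve E (Affine x y) \<longleftrightarrow> on_affine E x y"

text \<open>
  The chord-tangent law. The negative of \<open>(x, y)\<close> is \<open>(x, - y - a1 x - a3)\<close>, so the first test
  below says that the two points are inverse to each other. Otherwise \<open>l\<close> is the slope and \<open>n\<close>
  the intercept of the line through them (the tangent if they coincide); the sum is the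
  negative of the third point of intersection.
\<close>

fun add_points :: "'a::field weierstrass \<Rightarrow> 'a point \<Rightarrow> 'a point \<Rightarrow> 'a point" where
  "add_points E Infinity Q = Q"
| "add_points E P Infinity = P"
| "add_points (Weierstrass a1 a2 a3 a4 a6) (Affine x1 y1) (Affine x2 y2) =
    (if x1 = x2 \<and> y2 = - y1 - a1 * x1 - a3 then Infinity
     else
       let l = (if x1 = x2
                then (3 * x1^2 + 2 * a2 * x1 + a4 - a1 * y1) / (2 * y1 + a1 * x1 + a3)
                else (y2 - y1) / (x2 - x1));
           n = y1 - l * x1;
           x3 = l^2 + a1 * l - a2 - x1 - x2
       in Affine x3 (- (l + a1) * x3 - n - a3))"

definition point_group :: "'a::field weierstrass \<Rightarrow> 'a point monoid" where
  "point_group E = \<lparr>carrier = {P. on_curve E P}, mult = add_points E, one = Infinity\<rparr>"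

definition torsion_group :: "'a::field weierstrass \<Rightarrow> nat \<Rightarrow> 'a point monoid" where
  "torsion_group E n = (point_group E)
     \<lparr>carrier := {P \<in> carrier (point_group E). P [^]\<^bsub>point_group E\<^esub> n = \<one>\<^bsub>point_group E\<^esub>}\<rparr>"


section \<open>Isomorphism over the ground field\<close>

text \<open>
  \<open>change_vars u r s t E\<close> is the equation in \<open>x'\<close>, \<open>y'\<close> that results from substituting
  \<open>x = u\<^sup>2 x' + r\<close>, \<open>y = u\<^sup>3 y' + s u\<^sup>2 x' + t\<close> into \<open>E\<close> and dividing by \<open>u\<^sup>6\<close>. Isomorphisms
  over the ground field of curves in Weierstrass form, mapping the point at infinity to the
  point at infinity, are exactly these substitutions with \<open>u\<close>, \<open>r\<close>, \<open>s\<close>, \<open>t\<close> in the ground field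
  and \<open>u \<noteq> 0\<close>.
\<close>

fun change_vars :: "'a::field \<Rightarrow> 'a \<Rightarrow> 'a \<Rightarrow> 'a \<Rightarrow> 'a weierstrass \<Rightarrow> 'a weierstrass" where
  "change_vars u r s t (Weierstrass a1 a2 a3 a4 a6) = Weierstrass
     ((a1 + 2 * s) / u)
     ((a2 - s * a1 + 3 * r - s^2) / u^2)
     ((a3 + r * a1 + 2 * t) / u^3)
     ((a4 - s * a3 + 2 * r * a2 - (t + r * s) * a1 + 3 * r^2 - 2 * s * t) / u^4)
     ((a6 + r * a4 + r^2 * a2 + r^3 - t * a3 - t^2 - r * t * a1) / u^6)"

definition curve_iso :: "('a::field weierstrass \<times> 'a weierstrass) set" where
  "curve_iso = {(E, E'). elliptic_curve E \<and> elliptic_curve E' \<and>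
                         (\<exists>u r s t. u \<noteq> 0 \<and> E' = change_vars u r s t E)}"

definition curve_classes :: "'a::field weierstrass set set" where
  "curve_classes = {E. elliptic_curve E} // curve_iso"

lemma change_vars_coeffs:
  assumes "u \<noteq> 0"
    and "change_vars u r s t (Weierstrass a1 a2 a3 a4 a6) = Weierstrass b1 b2 b3 b4 b6"
  shows "a1 = u * b1 - 2 * s"
    and "a2 = u^2 * b2 + s * a1 - 3 * r + s^2"
    and "a3 = u^3 * b3 - r * a1 - 2 * t"
    and "a4 = u^4 * b4 + s * a3 - 2 * r * a2 + (t + r * s) * a1 - 3 * r^2 + 2 * s * t"
    and "a6 = u^6 * b6 - r * a4 - r^2 * a2 - r^3 + t * a3 + t^2 + r * t * a1"
  using assms by auto

lemma on_affine_change_vars: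
  assumes "u \<noteq> 0"
  shows "on_affine (change_vars u r s t E) x y \<longleftrightarrow>
         on_affine E (u^2 * x + r) (u^3 * y + s * u^2 * x + t)"
proof (cases E)
  case (Weierstrass a1 a2 a3 a4 a6)
  obtain b1 b2 b3 b4 b6
    where b: "change_vars u r s t (Weierstrass a1 a2 a3 a4 a6) = Weierstrass b1 b2 b3 b4 b6"
    by (cases "change_vars u r s t (Weierstrass a1 a2 a3 a4 a6)")
  define X Y where "X = u^2 * x + r" and "Y = u^3 * y + s * u^2 * x + t"
  have "u^6 * ((y^2 + b1 * x * y + b3 * y) - (x^3 + b2 * x^2 + b4 * x + b6))
      = (Y^2 + a1 * X * Y + a3 * Y) - (X^3 + a2 * X^2 + a4 * X + a6)"
    using change_vars_coeffs[OF assms b] unfolding X_def Y_def by algebra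
  moreover have "u^6 \<noteq> 0" using assms by simp
  ultimately have "y^2 + b1 * x * y + b3 * y = x^3 + b2 * x^2 + b4 * x + b6 \<longleftrightarrow>
      Y^2 + a1 * X * Y + a3 * Y = X^3 + a2 * X^2 + a4 * X + a6"
    by (metis eq_iff_diff_eq_0 mult_eq_0_iff)
  then show ?thesis
    by (simp add: Weierstrass b X_def Y_def del: change_vars.simps)
qed

lemma change_vars_id: "change_vars 1 0 0 0 E = E"
  by (cases E) simp

lemma change_vars_comp:
  assumes "u \<noteq> 0" "v \<noteq> 0"
  shows "change_vars v r' s' t' (change_vars u r s t E) =
    change_vars (u * v) (u^2 * r' + r) (u * s' + s) (u^3 * t' + u^2 * r' * s + t) E"
proof (cases E)
  case (Weierstrass a1 a2 a3 a4 a6)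
  obtain b1 b2 b3 b4 b6
    where b: "change_vars u r s t (Weierstrass a1 a2 a3 a4 a6) = Weierstrass b1 b2 b3 b4 b6"
    by (cases "change_vars u r s t (Weierstrass a1 a2 a3 a4 a6)")
  define R S T where "R = u^2 * r' + r" and "S = u * s' + s" and "T = u^3 * t' + u^2 * r' * s + t"
  note eqs = change_vars_coeffs[OF assms(1) b]
  have "a1 + 2 * S = u * (b1 + 2 * s')"
    using eqs unfolding S_def by algebra
  moreover have "a2 - S * a1 + 3 * R - S^2 = u^2 * (b2 - s' * b1 + 3 * r' - s'^2)"
    using eqs unfolding R_def S_def by algebra
  moreover have "a3 + R * a1 + 2 * T = u^3 * (b3 + r' * b1 + 2 * t')"
    using eqs unfolding R_def T_def by algebra
  moreover have "a4 - S * a3 + 2 * R * a2 - (T + R * S) * a1 + 3 * R^2 - 2 * S * T =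
      u^4 * (b4 - s' * b3 + 2 * r' * b2 - (t' + r' * s') * b1 + 3 * r'^2 - 2 * s' * t')"
    using eqs unfolding R_def S_def T_def by algebra
  moreover have "a6 + R * a4 + R^2 * a2 + R^3 - T * a3 - T^2 - R * T * a1 =
      u^6 * (b6 + r' * b4 + r'^2 * b2 + r'^3 - t' * b3 - t'^2 - r' * t' * b1)"
    using eqs unfolding R_def T_def by algebra
  ultimately have "change_vars (u * v) R S T (Weierstrass a1 a2 a3 a4 a6) =
      change_vars v r' s' t' (Weierstrass b1 b2 b3 b4 b6)"
    using assms by (simp add: power_mult_distrib)
  then show ?thesis
    unfolding Weierstrass b R_def S_def T_def ..
qed

lemma curve_isoI:
  "elliptic_curve E \<Longrightarrow> elliptic_curve E' \<Longrightarrow> u \<noteq> 0 \<Longrightarrow> E' = change_vars u r s t E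
    \<Longrightarrow> (E, E') \<in> curve_iso"
  unfolding curve_iso_def by blast

lemma equiv_curve_iso: "equiv {E :: 'a::field weierstrass. elliptic_curve E} curve_iso"
  (is "equiv ?A ?R")
proof (rule equivI)
  show "?R \<subseteq> ?A \<times> ?A"
    by (auto simp: curve_iso_def)
  show "refl_on ?A ?R"
    unfolding refl_on_def curve_iso_def
    using change_vars_id[symmetric] zero_neq_one[symmetric] by blast
  show "sym ?R"
  proof (rule symI)
    fix E E' :: "'a weierstrass"
    assume a: "(E, E') \<in> curve_iso"
    then obtain u r s t where u: "u \<noteq> 0" and E': "E' = change_vars u r s t E"
      by (auto simp: curve_iso_def)
    have inv: "E = change_vars (1 / u) (- r / u^2) (- s / u) ((r * s - t) / u^3) E'"
      using u by (simp add: E' change_vars_comp field_simps change_vars_id)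
    show "(E', E) \<in> curve_iso"
      using a u by (intro curve_isoI[OF _ _ _ inv]) (simp_all add: curve_iso_def)
  qed
  show "trans ?R"
  proof (rule transI)
    fix E E' E'' :: "'a weierstrass"
    assume a: "(E, E') \<in> curve_iso" and b: "(E', E'') \<in> curve_iso"
    obtain u r s t where "u \<noteq> 0" "E' = change_vars u r s t E"
      using a by (auto simp: curve_iso_def)
    moreover obtain v r' s' t' where "v \<noteq> 0" "E'' = change_vars v r' s' t' E'"
      using b by (auto simp: curve_iso_def)
    ultimately have nz: "u * v \<noteq> 0" and comp: "E'' =
      change_vars (u * v) (u^2 * r' + r) (u * s' + s) (u^3 * t' + u^2 * r' * s + t) E"
      by (simp_all add: change_vars_comp)
    show "(E, E'') \<in> curve_iso"
      using a b nz by (intro curve_isoI[OF _ _ _ comp]) (simp_all add: curve_iso_def)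
  qed
qed

end

(*
  A point P is a nonzero 3-torsion point iff it is a flex (2 P = - P), so the 3-torsion is
  non-cyclic iff there are two affine flexes with distinct x-coordinates. Moving one of them to
  the origin with horizontal tangent gives y^2 + a x y + b y = x^3, and a second flex makes
  a^3 - 27 b a cube c^3. Scaling by c leads to the Hesse family
  E_l: y^2 + l x y + (l^3 - 1)/27 y = x^3 with l^3 \<noteq> 1.
  Two members are isomorphic iff l and m lie in one orbit of the tetrahedral group generated by
  l \<mapsto> w l (w a primitive cube root of unity) and l \<mapsto> (l + 2)/(l - 1), which happens iff
  J(l) = J(m) for J = L (L + 8)^3 / (L - 1)^3, L = l^3 (up to a factor 27 the j-invariant).
  So the classes are the values of J on the q - 3 parameters. The fibre over 0 has 4 elements
  (1 in characteristic 2), the fibre over 64 has 0 or 6 (it coincides with the one over 0 in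
  characteristic 2), and all others have 12; this also determines q mod 12 in each case.
*)

theory Submission
  imports Defs "HOL-Computational_Algebra.Polynomial"
begin

section \<open>Finite fields\<close>

lemma finite_field_power_card_minus_1:
  fixes x :: "'a::{field,finite}"
  assumes "x \<noteq> 0"
  shows "x ^ (CARD('a) - 1) = 1"
proof -
  let ?U = "UNIV - {0::'a}"
  have "bij_betw ((*) x) ?U ?U"
    by (rule bij_betwI[where g = "\<lambda>y. y / x"]) (use assms in auto)
  then have "(\<Prod>y\<in>?U. y) = (\<Prod>y\<in>?U. x * y)"
    by (rule prod.reindex_bij_betw[symmetric])
  also have "\<dots> = x ^ card ?U * (\<Prod>y\<in>?U. y)"
    by (simp add: prod.distrib)
  finally show ?thesis
    by (simp add: card_Diff_singleton)
qed

lemma finite_field_of_nat_card: "of_nat CARD('a) = (0::'a::{field,finite})"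
proof -
  have "bij_betw (\<lambda>y::'a. y + 1) UNIV UNIV"
    by (rule bij_betwI[where g = "\<lambda>y. y - 1"]) auto
  then have "(\<Sum>y::'a\<in>UNIV. y) = (\<Sum>y\<in>UNIV. y + 1)"
    by (rule sum.reindex_bij_betw[symmetric])
  also have "\<dots> = (\<Sum>y\<in>UNIV. y) + of_nat CARD('a)"
    by (simp add: sum.distrib)
  finally show ?thesis
    by simp
qed

text \<open>At most \<open>m = (q - 1) / 3\<close> elements satisfy \<open>x ^ m = 1\<close>, fewer
  than the \<open>3 * m\<close> nonzero ones, so some \<open>x ^ m\<close> is a cube root of unity
  other than 1.\<close>

lemma finite_field_primitive_cube_root:
  assumes "CARD('a::{field,finite}) mod 3 = 1"
  obtains w :: "'a::{field,finite}" where "w^2 + w + 1 = 0" and "(3::'a::{field,finite}) \<noteq> 0"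
proof -
  define m where "m = CARD('a) div 3"
  have q: "CARD('a) = 3 * m + 1"
    unfolding m_def using assms by presburger
  \<comment> \<open>The cardinality vanishes in the field; if 3 vanished too,
    \<open>q = 3 * m + 1\<close> would give \<open>1 = 0\<close>.\<close>
  have three: "(3::'a) \<noteq> 0"
    using finite_field_of_nat_card[where 'a = 'a] by (auto simp: q)
  have "card {0, 1 :: 'a} \<le> CARD('a)"
    by (rule card_mono) auto
  then have "m > 0"
    using q by auto
  define p where "p = Polynomial.monom (1::'a) m - 1"
  have "coeff p m = 1" "degree p \<le> m"
    using \<open>m > 0\<close> by (auto simp: p_def degree_monom_le intro: degree_diff_le)
  then have "degree p = m" "p \<noteq> 0"
    using le_degree[of p m] by auto
  then have "card {x. poly p x = 0} \<le> m"
    using card_poly_roots_bound[of p] by simp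
  moreover have "card (UNIV - {0::'a}) = 3 * m"
    by (simp add: card_Diff_singleton q)
  ultimately have "\<not> UNIV - {0} \<subseteq> {x. poly p x = 0}"
    using card_mono[of "{x. poly p x = 0}" "UNIV - {0}"] \<open>m > 0\<close> by fastforce
  then obtain x :: "'a::{field,finite}" where x: "x \<noteq> 0" "x ^ m \<noteq> 1"
    by (auto simp: p_def poly_monom)
  define w where "w = x ^ m"
  have "w ^ 3 = 1"
    using finite_field_power_card_minus_1[OF x(1)]
    by (simp add: q w_def mult.commute flip: power_mult)
  then have "(w - 1) * (w^2 + w + 1) = 0"
    by algebra
  then show thesis
    using x three that[of w] by (auto simp: w_def)
qed

section \<open>The Hesse parameter\<close>

definition hesse_j :: "'a::field \<Rightarrow> 'a" where
  "hesse_j l = l^3 * (l^3 + 8)^3 / (l^3 - 1)^3"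

lemma hesse_j_eq_iff_poly:
  assumes "l^3 \<noteq> 1" "m^3 \<noteq> 1"
  shows "hesse_j l = hesse_j m \<longleftrightarrow>
    l^3 * (l^3 + 8)^3 * (m^3 - 1)^3 = m^3 * (m^3 + 8)^3 * (l^3 - 1)^3"
  using assms by (simp add: hesse_j_def frac_eq_eq)

lemma hesse_j_eq_0_iff:
  assumes "l^3 \<noteq> 1"
  shows "hesse_j l = 0 \<longleftrightarrow> l * (l^3 + 8) = 0"
  using assms by (simp add: hesse_j_def)

text \<open>64 is 1728 / 27, and \<open>l^6 - 20 * l^3 - 8\<close> is, up to sign and a factor 27,
  the invariant c6 of the Hesse curve: the identity below is c4^3 - 1728 Delta = c6^2.\<close>

lemma hesse_j_eq_64_iff:
  assumes "l^3 \<noteq> 1"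
  shows "hesse_j l = 64 \<longleftrightarrow> l^6 - 20 * l^3 - 8 = 0"
proof -
  have "l^3 * (l^3 + 8)^3 - 64 * (l^3 - 1)^3 = (l^6 - 20 * l^3 - 8)^2"
    by algebra
  then show ?thesis
    using assms unfolding hesse_j_def
    by (metis divide_eq_eq eq_iff_diff_eq_0 power_eq_0_iff zero_less_numeral zero_neq_numeral)
qed

text \<open>Outside characteristic 3 this Moebius map exchanges 1 with infinity and the two
  primitive cube roots of unity with each other, so it permutes the poles of
  \<open>hesse_j\<close>.\<close>

definition hesse_involution :: "'a::field \<Rightarrow> 'a" where
  "hesse_involution l = (l + 2) / (l - 1)"

lemma hesse_involution_cube_eq_iff:
  fixes l :: "'a::field"
  assumes "l \<noteq> 1"
  shows "m^3 = (hesse_involution l)^3 \<longleftrightarrow> m^3 * (l - 1)^3 - (l + 2)^3 = 0"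
  using assms by (simp add: hesse_involution_def power_divide eq_divide_eq)

section \<open>Orbits of the tetrahedral group on the parameters\<close>

context
  fixes w :: "'a::field"
  assumes w: "w^2 + w + 1 = 0" and three: "(3::'a) \<noteq> 0"
begin

lemma w_cube: "w^3 = 1"
  using w by algebra

lemma cube_eq_iff: "m^3 = l^3 \<longleftrightarrow> m = l \<or> m = w * l \<or> m = w^2 * l"
proof -
  have "m^3 - l^3 = (m - l) * (m - w * l) * (m - w^2 * l)"
    using w by algebra
  then show ?thesis
    by (metis eq_iff_diff_eq_0 mult_eq_0_iff)
qed

lemma w_neq_1: "w \<noteq> 1"
  using w three by auto

lemma card_cube_roots:
  fixes z :: 'a
  assumes "z \<noteq> 0"
  shows "card {m. m^3 = z^3} = 3"
proof -
  have "w \<noteq> 0" using w by auto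
  have "{m. m^3 = z^3} = {z, w * z, w^2 * z}"
    by (auto simp: cube_eq_iff)
  moreover have "w * z \<noteq> z" "w^2 * z \<noteq> w * z"
    using assms w_neq_1 \<open>w \<noteq> 0\<close> by (auto simp: power2_eq_square)
  moreover have "w^2 \<noteq> 1"
    using w_cube w_neq_1 by (auto simp: power3_eq_cube power2_eq_square)
  ultimately show ?thesis
    using assms by auto
qed

text \<open>The twelve bilinear forms that cut out the orbits of the tetrahedral group, gathered by
  their cubes, multiply up to the degree-12 equation of the fibres of \<open>hesse_j\<close>.\<close>

lemma hesse_j_eq_iff:
  assumes l: "l^3 \<noteq> 1" and m: "m^3 \<noteq> 1"
  shows "hesse_j l = hesse_j m \<longleftrightarrow> m^3 = l^3 \<or> m^3 = (hesse_involution l)^3 \<or>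
    m^3 = (hesse_involution (w * l))^3 \<or> m^3 = (hesse_involution (w^2 * l))^3"
proof -
  \<comment> \<open>These are the coefficients left in \<open>m^3 * (x - 1)^3 - (x + 2)^3\<close>
    once \<open>x^3\<close> is replaced by \<open>l^3\<close>.\<close>
  define A B C where "A = m^3 * (l^3 - 1) - (l^3 + 8)" and "B = 3 * m^3 - 12"
    and "C = - 3 * m^3 - 6"
  have *: "m^3 * (x - 1)^3 - (x + 2)^3 = A + B * x + C * x^2" if "x^3 = l^3" for x
    using that unfolding A_def B_def C_def by algebra
  have wl: "(w * l)^3 = l^3" "(w^2 * l)^3 = l^3"
    using w by algebra+
  then have nz: "l \<noteq> 1" "w * l \<noteq> 1" "w^2 * l \<noteq> 1"
    using l by auto
  \<comment> \<open>The product over the three rotations of \<open>l\<close> is a norm, hence a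
    polynomial in \<open>l^3\<close>.\<close>
  have norm: "(A + B * l + C * l^2) * (A + B * (w * l) + C * (w * l)^2) * (A + B * (w^2 * l) + C * (w^2 * l)^2)
    = A^3 + B^3 * l^3 + C^3 * l^6 - 3 * A * B * C * l^3"
    using w by algebra
  have "(m^3 - l^3) * (A^3 + B^3 * l^3 + C^3 * l^6 - 3 * A * B * C * l^3) =
    m^3 * (m^3 + 8)^3 * (l^3 - 1)^3 - l^3 * (l^3 + 8)^3 * (m^3 - 1)^3"
    unfolding A_def B_def C_def by algebra
  then have "l^3 * (l^3 + 8)^3 * (m^3 - 1)^3 = m^3 * (m^3 + 8)^3 * (l^3 - 1)^3 \<longleftrightarrow>
    m^3 - l^3 = 0 \<or> A + B * l + C * l^2 = 0 \<or> A + B * (w * l) + C * (w * l)^2 = 0 \<or>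
      A + B * (w^2 * l) + C * (w^2 * l)^2 = 0"
    unfolding norm[symmetric] by (metis eq_iff_diff_eq_0 mult_eq_0_iff)
  then show ?thesis
    using l m nz wl
    by (simp add: hesse_j_eq_iff_poly hesse_involution_cube_eq_iff * del: power_mult_distrib)
qed

text \<open>For \<open>m^3 = l^3\<close> the norm above becomes \<open>(l^6 - 20 l^3 - 8) (l^3 + 8)^2 (l^3 - 1)^2\<close>, so away
  from the two special values of \<open>hesse_j\<close> the involution moves the cube.\<close>

lemma hesse_involution_cube_neq:
  assumes l: "l^3 \<noteq> 1" and special: "hesse_j l \<noteq> 0" "hesse_j l \<noteq> 64"
  shows "l^3 \<noteq> (hesse_involution l)^3"
proof
  assume "l^3 = (hesse_involution l)^3"
  then have "l^3 * (l - 1)^3 - (l + 2)^3 = 0"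
    using l hesse_involution_cube_eq_iff[of l l] by (cases "l = 1") auto
  then have "(l^6 - 20 * l^3 - 8) * (l^3 + 8)^2 * (l^3 - 1)^2 = 0"
    by algebra
  then show False
    using l special by (simp add: hesse_j_eq_0_iff hesse_j_eq_64_iff)
qed

text \<open>After clearing denominators, equality reads \<open>a^3 = b^3\<close>. The factor
  \<open>a - b\<close> is a multiple of \<open>l\<close>, and \<open>a^2 + a * b + b^2\<close>
  splits into two quadratics; any zero of these makes \<open>hesse_j l\<close> equal to 0 or
  64.\<close>

lemma hesse_involution_cube_neq_rotated:
  assumes l: "l^3 \<noteq> 1" and special: "hesse_j l \<noteq> 0" "hesse_j l \<noteq> 64"
  shows "(hesse_involution l)^3 \<noteq> (hesse_involution (w * l))^3"
proof
  assume eq: "(hesse_involution l)^3 = (hesse_involution (w * l))^3"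
  have nz: "l \<noteq> 1" "w * l \<noteq> 1"
    using l w_cube by (auto simp: power_mult_distrib dest: arg_cong[where f = "\<lambda>x. x^3"])
  then have "(l + 2)^3 * (w * l - 1)^3 = (w * l + 2)^3 * (l - 1)^3"
    using eq by (simp add: hesse_involution_def power_divide frac_eq_eq)
  moreover define a b where "a = (l + 2) * (w * l - 1)" and "b = (w * l + 2) * (l - 1)"
  ultimately have "(a - b) * (a^2 + a * b + b^2) = 0"
    by (simp only: flip: power_mult_distrib) algebra
  moreover have "a - b = 3 * (w - 1) * l"
    unfolding a_def b_def by algebra
  moreover have "a^2 + a * b + b^2 = 3 * ((w * l^2 - 2 * w^2 * l - 2) * (w * l^2 + w^2 * l - 2))"
    using w unfolding a_def b_def by algebra
  ultimately have "l = 0 \<or> w * l^2 - 2 * w^2 * l - 2 = 0 \<or> w * l^2 + w^2 * l - 2 = 0"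
    using three w_neq_1 by (metis mult_eq_0_iff right_minus_eq)
  moreover have "l^6 - 20 * l^3 - 8 = 0" if "w * l^2 - 2 * w^2 * l - 2 = 0"
    using that w by algebra
  moreover have "(l^3 + 8) * (l^3 - 1) = 0" if "w * l^2 + w^2 * l - 2 = 0"
    using that w by algebra
  ultimately show False
    using l special by (auto simp: hesse_j_eq_0_iff hesse_j_eq_64_iff)
qed

end

section \<open>Flexes and cyclicity\<close>

fun neg_point :: "'a::field weierstrass \<Rightarrow> 'a point \<Rightarrow> 'a point" where
  "neg_point E Infinity = Infinity"
| "neg_point (Weierstrass a1 a2 a3 a4 a6) (Affine x y) = Affine x (- y - a1 * x - a3)"

text \<open>The tangent slope \<open>l\<close> is an argument so that all conditions stay
  polynomial. The last one says that the third intersection of the tangent again has abscissa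
  \<open>x\<close>.\<close>

fun is_flex :: "'a::field weierstrass \<Rightarrow> 'a \<Rightarrow> 'a \<Rightarrow> 'a \<Rightarrow> bool" where
  "is_flex (Weierstrass a1 a2 a3 a4 a6) x y l \<longleftrightarrow>
    y^2 + a1 * x * y + a3 * y = x^3 + a2 * x^2 + a4 * x + a6 \<and>
    2 * y + a1 * x + a3 \<noteq> 0 \<and>
    l * (2 * y + a1 * x + a3) = 3 * x^2 + 2 * a2 * x + a4 - a1 * y \<and>
    l^2 + a1 * l - a2 = 3 * x"

lemma add_points_eq_Infinity_iff:
  "add_points E P Q = Infinity \<longleftrightarrow> Q = neg_point E P"
  by (cases "(E, P, Q)" rule: add_points.cases; cases E) (auto simp: Let_def)

lemma add_points_Infinity_right: "add_points E P Infinity = P"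
  by (cases P) (cases E, auto)+

lemma neg_point_neg_point: "neg_point E (neg_point E P) = P"
  by (cases "(E, P)" rule: neg_point.cases) auto

lemma double_eq_neg_iff_flex:
  "on_curve E (Affine x y) \<and> add_points E (Affine x y) (Affine x y) = neg_point E (Affine x y)
    \<longleftrightarrow> (\<exists>l. is_flex E x y l)"
proof (cases E)
  case (Weierstrass a1 a2 a3 a4 a6)
  have D: "y = - y - a1 * x - a3 \<longleftrightarrow> 2 * y + a1 * x + a3 = 0"
    by algebra
  define l where "l = (3 * x^2 + 2 * a2 * x + a4 - a1 * y) / (2 * y + a1 * x + a3)"
  have slope: "k * (2 * y + a1 * x + a3) = 3 * x^2 + 2 * a2 * x + a4 - a1 * y \<longleftrightarrow> k = l"
    if "2 * y + a1 * x + a3 \<noteq> 0" for k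
    using that by (auto simp: l_def eq_divide_eq)
  have X: "l^2 + a1 * l - a2 - x - x = x \<longleftrightarrow> l^2 + a1 * l - a2 = 3 * x"
    by (auto simp: algebra_simps)
  \<comment> \<open>The tangent passes through the point itself, so agreement of abscissas already
    forces agreement of ordinates.\<close>
  have "- (l + a1) * x - (y - l * x) - a3 = - y - a1 * x - a3"
    by algebra
  then have "add_points E (Affine x y) (Affine x y) = neg_point E (Affine x y) \<longleftrightarrow>
      2 * y + a1 * x + a3 \<noteq> 0 \<and> l^2 + a1 * l - a2 = 3 * x"
    using X by (auto simp: Weierstrass D Let_def simp flip: l_def)
  then show ?thesis
    using slope by (simp add: Weierstrass) metis
qed

text \<open>Negation of points is an affine map of the plane that carries lines of slope
  \<open>l\<close> to lines of slope \<open>- l - a1\<close>.\<close>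

lemma is_flex_neg:
  assumes "is_flex (Weierstrass a1 a2 a3 a4 a6) x y l"
  shows "is_flex (Weierstrass a1 a2 a3 a4 a6) x (- y - a1 * x - a3) (- l - a1)"
proof -
  have "2 * (- y - a1 * x - a3) + a1 * x + a3 = - (2 * y + a1 * x + a3)"
    by algebra
  moreover have "(- l - a1) * (- (2 * y + a1 * x + a3)) =
      3 * x^2 + 2 * a2 * x + a4 - a1 * (- y - a1 * x - a3)"
    using assms by simp algebra
  moreover have "(- y - a1 * x - a3)^2 + a1 * x * (- y - a1 * x - a3) + a3 * (- y - a1 * x - a3)
      = x^3 + a2 * x^2 + a4 * x + a6"
    using assms by simp algebra
  moreover have "(- l - a1)^2 + a1 * (- l - a1) - a2 = 3 * x"
    using assms by simp algebra
  ultimately show ?thesis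
    using assms unfolding is_flex.simps by auto
qed

lemma is_flex_same_x:
  assumes "is_flex E x y l" "is_flex E x y' l'"
  shows "Affine x y' = Affine x y \<or> Affine x y' = neg_point E (Affine x y)"
proof (cases E)
  case (Weierstrass a1 a2 a3 a4 a6)
  have "y^2 + a1 * x * y + a3 * y = y'^2 + a1 * x * y' + a3 * y'"
    using assms by (simp add: Weierstrass)
  then have "(y' - y) * (y' - (- y - a1 * x - a3)) = 0"
    by algebra
  then show ?thesis
    by (auto simp: Weierstrass)
qed

section \<open>The group of 3-torsion points and its cyclic subgroups\<close>

lemma torsion_group_simps:
  "monoid.mult (torsion_group E n) = add_points E" "monoid.one (torsion_group E n) = Infinity"
  by (simp_all add: torsion_group_def point_group_def)

lemma carrier_torsion_group_3:
  "carrier (torsion_group E 3) = {P. on_curve E P \<and> add_points E P P = neg_point E P}"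
proof -
  have "add_points E (add_points E P P) P = Infinity \<longleftrightarrow> add_points E P P = neg_point E P" for P
    by (metis add_points_eq_Infinity_iff neg_point_neg_point)
  then show ?thesis
    by (simp add: torsion_group_def point_group_def nat_pow_def numeral_3_eq_3)
qed

lemma affine_in_torsion_group_3_iff:
  "Affine x y \<in> carrier (torsion_group E 3) \<longleftrightarrow> (\<exists>l. is_flex E x y l)"
  by (simp add: carrier_torsion_group_3 double_eq_neg_iff_flex[symmetric])

lemma Infinity_in_torsion_group_3: "Infinity \<in> carrier (torsion_group E 3)"
  by (simp add: carrier_torsion_group_3)

lemma neg_in_torsion_group_3:
  assumes "P \<in> carrier (torsion_group E 3)"
  shows "neg_point E P \<in> carrier (torsion_group E 3)"
proof (cases "(E, P)" rule: neg_point.cases)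
  case (2 a1 a2 a3 a4 a6 x y)
  then show ?thesis
    using assms by (auto simp: affine_in_torsion_group_3_iff simp del: is_flex.simps dest: is_flex_neg)
qed (use assms in auto)

text \<open>The three points are closed under addition because 2 P = - P and 2 (- P) = P.\<close>

lemma generate_torsion_group_3:
  assumes P: "P \<in> carrier (torsion_group E 3)"
  shows "generate (torsion_group E 3) {P} = {Infinity, P, neg_point E P}"
    (is "generate ?G _ = ?S")
proof -
  have P': "neg_point E P \<in> carrier ?G"
    using P by (rule neg_in_torsion_group_3)
  have double: "add_points E P P = neg_point E P"
    "add_points E (neg_point E P) (neg_point E P) = P"
    using P P' by (auto simp: carrier_torsion_group_3 neg_point_neg_point)
  have cancel: "add_points E P (neg_point E P) = Infinity"
    "add_points E (neg_point E P) P = Infinity"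
    by (simp_all add: add_points_eq_Infinity_iff neg_point_neg_point)
  have inv: "inv\<^bsub>?G\<^esub> P = neg_point E P"
    unfolding m_inv_def torsion_group_simps
    using P' cancel add_points_eq_Infinity_iff by (intro the_equality) blast+
  show ?thesis
  proof
    show "generate ?G {P} \<subseteq> ?S"
    proof
      fix Q assume "Q \<in> generate ?G {P}"
      then show "Q \<in> ?S"
        by (induction rule: generate.induct)
          (auto simp: torsion_group_simps inv double cancel add_points_Infinity_right)
    qed
    show "?S \<subseteq> generate ?G {P}"
      using generate.one[of ?G "{P}"] generate.incl[of P "{P}" ?G] generate.inv[of P "{P}" ?G]
      by (auto simp: torsion_group_simps inv)
  qed
qed

text \<open>In a cyclic 3-torsion group all affine points are \<open>P\<close> or its negative and
  share one abscissa; conversely, two flexes with equal abscissa are equal or opposite.\<close>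

lemma not_cyclic_torsion_group_3_iff:
  "\<not> cyclic_group (torsion_group E 3) \<longleftrightarrow>
    (\<exists>x y l x' y' l'. is_flex E x y l \<and> is_flex E x' y' l' \<and> x \<noteq> x')"
proof -
  let ?G = "torsion_group E 3"
  have cyc: "cyclic_group ?G \<longleftrightarrow>
    (\<exists>P\<in>carrier ?G. carrier ?G = {Infinity, P, neg_point E P})"
  proof -
    have "subgroup_generated ?G {P} = ?G \<longleftrightarrow> carrier ?G = {Infinity, P, neg_point E P}"
      if "P \<in> carrier ?G" for P
    proof -
      \<comment> \<open>\<open>cyclic_group\<close> compares whole records, and these two can differ
        only in the carrier.\<close>
      have "subgroup_generated ?G {P} = ?G\<lparr>carrier := {Infinity, P, neg_point E P}\<rparr>"
        using that generate_torsion_group_3[OF that] by (simp add: subgroup_generated_def)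
      moreover have "?G\<lparr>carrier := carrier ?G\<rparr> = ?G"
        by simp
      moreover have "carrier (?G\<lparr>carrier := S\<rparr>) = S" for S
        by simp
      ultimately show ?thesis
        by metis
    qed
    then show ?thesis
      unfolding cyclic_group_def by blast
  qed
  show ?thesis
  proof
    assume nc: "\<not> cyclic_group ?G"
    \<comment> \<open>Trivial 3-torsion counts as cyclic, with generator
      \<open>Infinity\<close>.\<close>
    have "carrier ?G \<noteq> {Infinity}"
    proof
      assume "carrier ?G = {Infinity}"
      then have "carrier ?G = {Infinity, Infinity, neg_point E Infinity}"
        by simp
      then show False
        using nc Infinity_in_torsion_group_3[of E] unfolding cyc by blast
    qed
    then obtain Q0 where "Q0 \<in> carrier ?G" "Q0 \<noteq> Infinity"
      using Infinity_in_torsion_group_3[of E] by blast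
    then obtain x y where "Affine x y \<in> carrier ?G"
      by (cases Q0) auto
    then obtain l where P: "Affine x y \<in> carrier ?G" "is_flex E x y l"
      by (auto simp: affine_in_torsion_group_3_iff)
    have "{Infinity, Affine x y, neg_point E (Affine x y)} \<subseteq> carrier ?G"
      using P(1) neg_in_torsion_group_3 Infinity_in_torsion_group_3 by blast
    then obtain Q where Q: "Q \<in> carrier ?G"
      "Q \<notin> {Infinity, Affine x y, neg_point E (Affine x y)}"
      using nc P(1) unfolding cyc by blast
    then obtain x' y' l' where "Q = Affine x' y'" "is_flex E x' y' l'"
      by (cases Q) (auto simp: affine_in_torsion_group_3_iff)
    then show "\<exists>x y l x' y' l'. is_flex E x y l \<and> is_flex E x' y' l' \<and> x \<noteq> x'"
      using P(2) Q(2) is_flex_same_x by blast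
  next
    assume "\<exists>x y l x' y' l'. is_flex E x y l \<and> is_flex E x' y' l' \<and> x \<noteq> x'"
    then obtain x y x' y' where *: "Affine x y \<in> carrier ?G" "Affine x' y' \<in> carrier ?G" "x \<noteq> x'"
      unfolding affine_in_torsion_group_3_iff by blast
    show "\<not> cyclic_group ?G"
    proof
      assume "cyclic_group ?G"
      then obtain P where "carrier ?G = {Infinity, P, neg_point E P}"
        unfolding cyc by blast
      then show False
        using * by (cases "(E, P)" rule: neg_point.cases) auto
    qed
  qed
qed

section \<open>Curves with full rational 3-torsion\<close>

fun c4_invariant :: "'a::field weierstrass \<Rightarrow> 'a" where
  "c4_invariant (Weierstrass a1 a2 a3 a4 a6) = (a1^2 + 4 * a2)^2 - 24 * (2 * a4 + a1 * a3)"

text \<open>Both invariants are polynomials in b2, b4, b6, b8, and in the transformation of these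
  \<open>s\<close> and \<open>t\<close> drop out, leaving only \<open>r\<close> and a power of
  \<open>u\<close>.\<close>

lemma invariants_change_vars:
  assumes "u \<noteq> 0"
  shows "u^4 * c4_invariant (change_vars u r s t E) = c4_invariant E"
    and "u^12 * discriminant (change_vars u r s t E) = discriminant E"
proof -
  obtain a1 a2 a3 a4 a6 where E: "E = Weierstrass a1 a2 a3 a4 a6"
    by (cases E)
  obtain d1 d2 d3 d4 d6
    where d: "change_vars u r s t (Weierstrass a1 a2 a3 a4 a6) = Weierstrass d1 d2 d3 d4 d6"
    by (cases "change_vars u r s t (Weierstrass a1 a2 a3 a4 a6)")
  note eqs = change_vars_coeffs[OF assms d]
  define b2 b4 b6 b8 where "b2 = a1^2 + 4 * a2" and "b4 = 2 * a4 + a1 * a3"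
    and "b6 = a3^2 + 4 * a6"
    and "b8 = a1^2 * a6 + 4 * a2 * a6 - a1 * a3 * a4 + a2 * a3^2 - a4^2"
  note b_defs = this
  define b2' b4' b6' b8' where "b2' = d1^2 + 4 * d2" and "b4' = 2 * d4 + d1 * d3"
    and "b6' = d3^2 + 4 * d6"
    and "b8' = d1^2 * d6 + 4 * d2 * d6 - d1 * d3 * d4 + d2 * d3^2 - d4^2"
  note b'_defs = this
  have b2': "u^2 * b2' = b2 + 12 * r"
    using eqs(1,2) unfolding b_defs b'_defs by algebra
  have b4': "u^4 * b4' = b4 + r * b2 + 6 * r^2"
    using eqs(1-4) unfolding b_defs b'_defs by algebra
  have b6': "u^6 * b6' = b6 + 2 * r * b4 + r^2 * b2 + 4 * r^3"
    using eqs(3,5) unfolding b_defs b'_defs by algebra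
  have e: "u * d1 = a1 + 2 * s" "u^2 * d2 = a2 - s * a1 + 3 * r - s^2"
    "u^3 * d3 = a3 + r * a1 + 2 * t"
    "u^4 * d4 = a4 - s * a3 + 2 * r * a2 - (t + r * s) * a1 + 3 * r^2 - 2 * s * t"
    "u^6 * d6 = a6 + r * a4 + r^2 * a2 + r^3 - t * a3 - t^2 - r * t * a1"
    using eqs by algebra+
  have "u^8 * b8' = (u * d1)^2 * (u^6 * d6) + 4 * (u^2 * d2) * (u^6 * d6)
      - (u * d1) * (u^3 * d3) * (u^4 * d4) + (u^2 * d2) * (u^3 * d3)^2 - (u^4 * d4)^2"
    unfolding b'_defs by algebra
  also have "\<dots> = b8 + 3 * r * b6 + 3 * r^2 * b4 + r^3 * b2 + 3 * r^4"
    unfolding e b_defs by algebra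
  finally have b8': "u^8 * b8' = b8 + 3 * r * b6 + 3 * r^2 * b4 + r^3 * b2 + 3 * r^4" .
  have rel: "4 * b8 = b2 * b6 - b4^2"
    unfolding b_defs by algebra
  have "u^4 * (b2'^2 - 24 * b4') = (u^2 * b2')^2 - 24 * (u^4 * b4')"
    by algebra
  also have "\<dots> = b2^2 - 24 * b4"
    unfolding b2' b4' by algebra
  finally show "u^4 * c4_invariant (change_vars u r s t E) = c4_invariant E"
    by (simp add: E d b_defs b'_defs del: change_vars.simps)
  have "u^12 * (- (b2'^2 * b8') - 8 * b4'^3 - 27 * b6'^2 + 9 * b2' * b4' * b6') =
      - ((u^2 * b2')^2 * (u^8 * b8')) - 8 * (u^4 * b4')^3 - 27 * (u^6 * b6')^2
      + 9 * (u^2 * b2') * (u^4 * b4') * (u^6 * b6')"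
    by algebra
  also have "\<dots> = - (b2^2 * b8) - 8 * b4^3 - 27 * b6^2 + 9 * b2 * b4 * b6"
    using rel unfolding b2' b4' b6' b8' by algebra
  finally show "u^12 * discriminant (change_vars u r s t E) = discriminant E"
    by (simp add: E d b_defs b'_defs Let_def del: change_vars.simps)
qed

lemma curve_iso_change_vars:
  assumes "elliptic_curve E" "u \<noteq> 0"
  shows "(E, change_vars u r s t E) \<in> curve_iso"
  using assms invariants_change_vars(2)[OF assms(2), of r s t E]
  by (intro curve_isoI) (auto simp: elliptic_curve_def)

lemma curve_iso_trans: "(E, E') \<in> curve_iso \<Longrightarrow> (E', E'') \<in> curve_iso \<Longrightarrow> (E, E'') \<in> curve_iso"
  using equiv_curve_iso by (blast elim: equivE dest: transD)

text \<open>The quotient is the j-invariant: numerator and denominator both scale by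
  \<open>u^12\<close>.\<close>

lemma curve_iso_imp_invariants_eq:
  assumes "(E, E') \<in> curve_iso"
  shows "(c4_invariant E)^3 / discriminant E = (c4_invariant E')^3 / discriminant E'"
proof -
  obtain u r s t where u: "u \<noteq> 0" and E': "E' = change_vars u r s t E"
    using assms by (auto simp: curve_iso_def)
  have "(c4_invariant E)^3 = u^12 * (c4_invariant E')^3"
    unfolding E' invariants_change_vars(1)[OF u, of r s t E, symmetric]
    by (simp add: power_mult_distrib flip: power_mult)
  then show ?thesis
    using u unfolding E' invariants_change_vars(2)[OF u, of r s t E, symmetric] by simp
qed

section \<open>Reduction to the Hesse family\<close>

definition hesse_curve :: "'a::field \<Rightarrow> 'a weierstrass" where
  "hesse_curve l = Weierstrass l 0 ((l^3 - 1) / 27) 0 0"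

text \<open>With the flex at the origin and its tangent horizontal, the curve, slope and flex
  equations say that the new a6, a4 and a2 vanish, respectively.\<close>

lemma is_flex_origin_change_vars:
  assumes "is_flex (Weierstrass a1 a2 a3 a4 a6) x y l"
  obtains a b where "change_vars 1 x l y (Weierstrass a1 a2 a3 a4 a6) = Weierstrass a 0 b 0 0"
    and "a = a1 + 2 * l" "b = 2 * y + a1 * x + a3"
proof -
  have on: "y^2 + a1 * x * y + a3 * y = x^3 + a2 * x^2 + a4 * x + a6"
    and slope: "l * (2 * y + a1 * x + a3) = 3 * x^2 + 2 * a2 * x + a4 - a1 * y"
    and flex: "l^2 + a1 * l - a2 = 3 * x"
    using assms by simp_all
  have "a2 - l * a1 + 3 * x - l^2 = 0"
    using flex by algebra
  moreover have "a4 - l * a3 + 2 * x * a2 - (y + x * l) * a1 + 3 * x^2 - 2 * l * y = 0"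
    using slope by algebra
  moreover have "a6 + x * a4 + x^2 * a2 + x^3 - y * a3 - y^2 - x * y * a1 = 0"
    using on by algebra
  ultimately show thesis
    using that by (simp add: algebra_simps)
qed

text \<open>For \<open>u = 1\<close> the substitution is affine: abscissas shift by
  \<open>r\<close>, slopes drop by \<open>s\<close>, and \<open>2 * y + a1 * x + a3\<close> keeps
  its value.\<close>

lemma is_flex_translate:
  assumes "is_flex E x y l" and "change_vars 1 r s t E = Weierstrass b1 b2 b3 b4 b6"
  shows "is_flex (Weierstrass b1 b2 b3 b4 b6) (x - r) (y - t - s * (x - r)) (l - s)"
proof (cases E)
  case (Weierstrass a1 a2 a3 a4 a6)
  note eqs = change_vars_coeffs[OF one_neq_zero assms(2)[unfolded Weierstrass], simplified]
  have on: "y^2 + a1 * x * y + a3 * y = x^3 + a2 * x^2 + a4 * x + a6"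
    and nz: "2 * y + a1 * x + a3 \<noteq> 0"
    and slope: "l * (2 * y + a1 * x + a3) = 3 * x^2 + 2 * a2 * x + a4 - a1 * y"
    and flex: "l^2 + a1 * l - a2 = 3 * x"
    using assms(1) by (simp_all add: Weierstrass)
  define X Y where "X = x - r" and "Y = y - t - s * X"
  have D: "2 * Y + b1 * X + b3 = 2 * y + a1 * x + a3"
    using eqs unfolding X_def Y_def by algebra
  have "Y^2 + b1 * X * Y + b3 * Y = X^3 + b2 * X^2 + b4 * X + b6"
    using on eqs unfolding Y_def X_def by algebra
  moreover have "(l - s) * (2 * Y + b1 * X + b3) = 3 * X^2 + 2 * b2 * X + b4 - b1 * Y"
    using slope eqs unfolding Y_def X_def by algebra
  moreover have "(l - s)^2 + b1 * (l - s) - b2 = 3 * X"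
    using flex eqs unfolding X_def by algebra
  ultimately show ?thesis
    using nz unfolding X_def[symmetric] Y_def[symmetric] is_flex.simps D by blast
qed

text \<open>The nonzero roots of the 3-division polynomial of \<open>y\<^sup>2 + a x y + b y = x\<^sup>3\<close> are
  \<open>x = 3 b / (c - a)\<close> for the cube roots \<open>c\<close> of \<open>a\<^sup>3 - 27 b\<close>.\<close>

lemma is_flex_imp_cube:
  assumes flex: "is_flex (Weierstrass a 0 b 0 0) x y l" and x: "x \<noteq> 0"
  shows "(3 * b / x + a)^3 = a^3 - 27 * b"
proof -
  define D where "D = 2 * y + a * x + b"
  have on: "y^2 + a * x * y + b * y = x^3"
    and slope: "l * D = 3 * x^2 - a * y"
    and flex: "l^2 + a * l = 3 * x"
    using flex by (simp_all add: D_def)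
  have "D^2 = 4 * x^3 + a^2 * x^2 + 2 * a * b * x + b^2"
    using on unfolding D_def by algebra
  \<comment> \<open>Multiplying the flex equation by \<open>D^2\<close> lets the slope equation
    eliminate \<open>l\<close>; comparison with \<open>D^2\<close> above yields the 3-division
    polynomial.\<close>
  moreover have "3 * x * D^2 = 9 * x^4 + 2 * a^2 * x^3 + 3 * a * b * x^2"
  proof -
    have "3 * x * D^2 = (3 * x^2 - a * y)^2 + a * (3 * x^2 - a * y) * D"
      unfolding flex[symmetric] slope[symmetric] by algebra
    also have "\<dots> = 9 * x^4 + 3 * a^2 * x^3 + 3 * a * b * x^2 - a^2 * (y^2 + a * x * y + b * y)"
      unfolding D_def by algebra
    finally show ?thesis
      unfolding on by algebra
  qed
  ultimately have "x * (3 * x^3 + a^2 * x^2 + 3 * a * b * x + 3 * b^2) = 0"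
    by algebra
  then have division: "3 * x^3 + a^2 * x^2 + 3 * a * b * x + 3 * b^2 = 0"
    using x by simp
  \<comment> \<open>Dividing the division polynomial by \<open>x^2\<close> makes it linear in
    \<open>x\<close>; multiplied by \<open>9 * z\<close>, it completes the cube of
    \<open>3 * z + a\<close>.\<close>
  define z where "z = b / x"
  have z: "z * x = b"
    using x by (simp add: z_def)
  have "x^2 * (3 * x + a^2 + 3 * a * z + 3 * z^2) = 0"
    using division unfolding z[symmetric] by algebra
  then have "3 * x + a^2 + 3 * a * z + 3 * z^2 = 0"
    using x by simp
  then have "(3 * z + a)^3 = a^3 - 27 * b"
    unfolding z[symmetric] by algebra
  then show ?thesis
    by (simp add: z_def)
qed

lemma discriminant_flex_form:
  "discriminant (Weierstrass a 0 b 0 0) = b^3 * (a^3 - 27 * b)"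
  by (simp add: Let_def) algebra

lemma nine_neq_0: "(3::'a::field) \<noteq> 0 \<Longrightarrow> (9::'a) \<noteq> 0"
  using power_not_zero[of "3::'a" 2] by simp

lemma twenty_seven_neq_0: "(3::'a::field) \<noteq> 0 \<Longrightarrow> (27::'a) \<noteq> 0"
  using power_not_zero[of "3::'a" 3] by simp

lemma not_cyclic_torsion_imp_hesse_curve:
  fixes E :: "'a::field weierstrass"
  assumes three: "(3::'a) \<noteq> 0" and E: "elliptic_curve E"
    and nc: "\<not> cyclic_group (torsion_group E 3)"
  obtains l where "l^3 \<noteq> 1" "(E, hesse_curve l) \<in> curve_iso"
proof -
  obtain x y k x' y' k' where P: "is_flex E x y k" and Q: "is_flex E x' y' k'" and "x' \<noteq> x"
    using nc unfolding not_cyclic_torsion_group_3_iff by metis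
  obtain a b where ab: "change_vars 1 x k y E = Weierstrass a 0 b 0 0"
    using P by (cases E) (metis is_flex_origin_change_vars)
  \<comment> \<open>After the translation the second flex has abscissa \<open>x' - x\<close>, which
    is nonzero, and it supplies a rational cube root of \<open>a^3 - 27 * b\<close>.\<close>
  define c where "c = 3 * b / (x' - x) + a"
  have c: "c^3 = a^3 - 27 * b"
    using is_flex_imp_cube[OF is_flex_translate[OF Q ab]] \<open>x' \<noteq> x\<close> by (simp add: c_def)
  have iso: "(E, Weierstrass a 0 b 0 0) \<in> curve_iso"
    using curve_iso_change_vars[OF E, of 1 x k y] by (simp add: ab)
  then have "b^3 * c^3 \<noteq> 0"
    unfolding c discriminant_flex_form[symmetric] by (simp add: curve_iso_def elliptic_curve_def)
  then have "b \<noteq> 0" "c \<noteq> 0"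
    by auto
  have nz: "(27::'a) \<noteq> 0"
    by (rule twenty_seven_neq_0[OF three])
  have "27 * b = a^3 - c^3"
    using c by algebra
  then have b: "b = (a^3 - c^3) / 27"
    using nz by (simp add: eq_divide_eq mult.commute)
  have l: "((a / c)^3 - 1) / 27 = b / c^3"
    using \<open>c \<noteq> 0\<close> nz by (simp add: b power_divide field_simps)
  have "change_vars c 0 0 0 (Weierstrass a 0 b 0 0) = hesse_curve (a / c)"
    by (simp add: hesse_curve_def l)
  moreover have "(Weierstrass a 0 b 0 0, change_vars c 0 0 0 (Weierstrass a 0 b 0 0)) \<in> curve_iso"
    using iso \<open>c \<noteq> 0\<close> by (intro curve_iso_change_vars) (auto simp: curve_iso_def)
  ultimately have "(E, hesse_curve (a / c)) \<in> curve_iso"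
    using iso by (simp add: curve_iso_trans)
  moreover have "(a / c)^3 \<noteq> 1"
    using l \<open>b \<noteq> 0\<close> \<open>c \<noteq> 0\<close> by (metis diff_self div_0 divide_eq_0_iff power_eq_0_iff)
  ultimately show thesis
    by (rule that[rotated])
qed

section \<open>Torsion and isomorphisms within the Hesse family\<close>

context
  fixes w :: "'a::field"
  assumes w: "w^2 + w + 1 = 0" and three: "(3::'a) \<noteq> 0"
begin

lemma discriminant_hesse_curve: "discriminant (hesse_curve l) = ((l^3 - 1 :: 'a) / 27)^3"
proof -
  define b where "b = (l^3 - 1) / 27"
  have "27 * b = l^3 - 1"
    using twenty_seven_neq_0[OF three] by (simp add: b_def)
  then have "l^3 - 27 * b = 1"
    by simp
  then show ?thesis
    unfolding hesse_curve_def discriminant_flex_form b_def[symmetric] by simp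
qed

lemma elliptic_curve_hesse_curve: "elliptic_curve (hesse_curve l) \<longleftrightarrow> (l::'a)^3 \<noteq> 1"
  using twenty_seven_neq_0[OF three] by (simp add: discriminant_hesse_curve elliptic_curve_def)

lemma c4_hesse_curve: "c4_invariant (hesse_curve l) = l * ((l::'a)^3 + 8) / 9"
proof -
  define b where "b = (l^3 - 1) / 27"
  have b: "27 * b = l^3 - 1"
    using twenty_seven_neq_0[OF three] by (simp add: b_def)
  have "3 * (9 * ((l^2)^2 - 24 * (l * b))) = 3 * (l * (l^3 + 8))"
    using b by algebra
  then have "9 * ((l^2)^2 - 24 * (l * b)) = l * (l^3 + 8)"
    using three mult_left_cancel by blast
  then show ?thesis
    using nine_neq_0[OF three]
    by (simp add: hesse_curve_def eq_divide_eq mult.commute flip: b_def)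
qed

lemma hesse_j_eq_invariants:
  "27 * hesse_j l = (c4_invariant (hesse_curve l))^3 / discriminant (hesse_curve (l::'a))"
proof -
  define A B where "A = l * (l^3 + 8)" and "B = l^3 - 1"
  have "A / 9 / (B / 27) = (9 * (3 * A)) / (9 * B)"
    by (simp add: mult.commute)
  also have "\<dots> = 3 * (A / B)"
    using nine_neq_0[OF three] by (simp only: nonzero_mult_divide_mult_cancel_left times_divide_eq_right not_False_eq_True)
  finally have ratio: "A / 9 / (B / 27) = 3 * (A / B)" .
  have "(A / 9)^3 / (B / 27)^3 = 3^3 * (A^3 / B^3)"
    by (simp only: ratio power_mult_distrib flip: power_divide)
  then have "(A / 9)^3 / (B / 27)^3 = 27 * (A^3 / B^3)"
    by simp
  then show ?thesis
    unfolding c4_hesse_curve discriminant_hesse_curve hesse_j_def A_def B_def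
    by (simp only: power_mult_distrib)
qed

text \<open>On the Hesse curve \<open>a^3 - 27 * b = 1\<close>. The cube root 1 gives the abscissa
  \<open>3 * b / (1 - l)\<close> of the second flex; solving for its ordinate and slope takes a
  square root of -3, namely \<open>2 * w + 1\<close>.\<close>

lemma is_flex_hesse_curve:
  assumes "(l::'a)^3 \<noteq> 1"
  shows "is_flex (hesse_curve l) 0 0 0"
    and "is_flex (hesse_curve l) (- (l^2 + l + 1) / 9) ((l^2 + l + 1) * (l - w) / 27)
      (((w - 1) * l + 2 * w + 1) / 3)"
proof -
  \<comment> \<open>With \<open>h\<close> as a symbol for 1/3, every identity below is polynomial
    modulo \<open>3 * h = 1\<close> and the equation of \<open>w\<close>.\<close>
  define h where "h = 1 / (3::'a)"
  have h: "3 * h = 1"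
    using three by (simp add: h_def)
  have h_powers: "h^2 = 1 / 9" "h^3 = 1 / 27"
    by (simp_all add: h_def power_divide)
  define b where "b = h^3 * (l^3 - 1)"
  define x y m where "x = - (h^2) * (l^2 + l + 1)" and "y = h^3 * (l^2 + l + 1) * (l - w)"
    and "m = h * ((w - 1) * l + 2 * w + 1)"
  have b: "b = (l^3 - 1) / 27" and x: "x = - (l^2 + l + 1) / 9"
    and y: "y = (l^2 + l + 1) * (l - w) / 27" and m: "m = ((w - 1) * l + 2 * w + 1) / 3"
    unfolding b_def x_def y_def m_def h_powers unfolding h_def
    by (simp_all only: mult_minus_left times_divide_eq_left mult_1 minus_divide_left)
  have "b \<noteq> 0"
    using assms twenty_seven_neq_0[OF three] by (simp add: b)
  then show "is_flex (hesse_curve l) 0 0 0"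
    by (simp add: hesse_curve_def b)
  have D0: "2 * y + l * x + b = - (h^3 * (2 * w + 1) * (l^2 + l + 1))"
    using h unfolding x_def y_def b_def by algebra
  have D: "(2 * w + 1) * (l - 1) * (2 * y + l * x + b) = 3 * b"
    using w unfolding D0 unfolding b_def by algebra
  have L: "y + l * x + b = - (h^3 * (l^2 + l + 1) * (l + w + 1))"
    using h unfolding x_def y_def b_def by algebra
  have "y * (y + l * x + b) = x^3"
    using w unfolding L unfolding x_def y_def by algebra
  then have "y^2 + l * x * y + b * y = x^3"
    by algebra
  moreover have R: "3 * x^2 - l * y = 3 * h^4 * (l^2 + l + 1) * (l + 1 + w * l)"
    using h unfolding x_def y_def by algebra
  have "m * (2 * y + l * x + b) = 3 * x^2 - l * y"
    using w unfolding D0 R unfolding m_def by algebra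
  moreover have M: "m + l = h * ((w + 2) * l + 2 * w + 1)"
    using h unfolding m_def by algebra
  have "m * (m + l) = 3 * x"
    using w unfolding M unfolding m_def x_def by algebra
  then have "m^2 + l * m = 3 * x"
    by algebra
  moreover have "2 * y + l * x + b \<noteq> 0"
    using D three \<open>b \<noteq> 0\<close> by auto
  ultimately show "is_flex (hesse_curve l) (- (l^2 + l + 1) / 9) ((l^2 + l + 1) * (l - w) / 27)
      (((w - 1) * l + 2 * w + 1) / 3)"
    unfolding x[symmetric] y[symmetric] m[symmetric] hesse_curve_def b[symmetric] by simp
qed

lemma not_cyclic_torsion_hesse_curve:
  assumes "(l::'a)^3 \<noteq> 1"
  shows "\<not> cyclic_group (torsion_group (hesse_curve l) 3)"
proof -
  have "(l - 1) * (l^2 + l + 1) = l^3 - 1"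
    by algebra
  then have "l^2 + l + 1 \<noteq> 0"
    using assms by auto
  then have "0 \<noteq> - (l^2 + l + 1) / 9"
    using nine_neq_0[OF three] by (metis divide_eq_0_iff neg_equal_0_iff_equal)
  then show ?thesis
    using is_flex_hesse_curve[OF assms] unfolding not_cyclic_torsion_group_3_iff by blast
qed

text \<open>The isomorphism moves the second flex to the origin.\<close>

lemma hesse_curve_iso_involution:
  assumes l: "(l::'a)^3 \<noteq> 1"
  shows "(hesse_curve l, hesse_curve (hesse_involution l)) \<in> curve_iso"
proof -
  define h where "h = 1 / (3::'a)"
  have h: "3 * h = 1"
    using three by (simp add: h_def)
  have h_powers: "h^2 = 1 / 9" "h^3 = 1 / 27"
    by (simp_all add: h_def power_divide)
  define x y m where "x = - (l^2 + l + 1) / 9" and "y = (l^2 + l + 1) * (l - w) / 27"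
    and "m = ((w - 1) * l + 2 * w + 1) / 3"
  \<comment> \<open>For the curve with the second flex at the origin, \<open>u\<close> is a cube
    root of \<open>a^3 - 27 * b\<close>; scaling by it restores the Hesse form.\<close>
  define u where "u = h * (2 * w + 1) * (l - 1)"
  have xym: "x = - (h^2) * (l^2 + l + 1)" "y = h^3 * (l^2 + l + 1) * (l - w)"
    "m = h * ((w - 1) * l + 2 * w + 1)"
    unfolding x_def y_def m_def h_powers unfolding h_def
    by (simp_all only: mult_minus_left times_divide_eq_left mult_1 minus_divide_left)
  have "(2 * w + 1)^2 = - 3"
    using w by algebra
  then have "2 * w + 1 \<noteq> 0" "l \<noteq> 1" "h \<noteq> 0"
    using three l h by auto
  then have u: "u \<noteq> 0"
    by (simp add: u_def)
  obtain a b where ab: "change_vars 1 x m y (hesse_curve l) = Weierstrass a 0 b 0 0"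
    and a: "a = l + 2 * m" and b: "b = 2 * y + l * x + (l^3 - 1) / 27"
    using is_flex_hesse_curve(2)[OF l] is_flex_origin_change_vars
    unfolding hesse_curve_def x_def y_def m_def by metis
  have "b = 2 * y + l * x + h^3 * (l^3 - 1)"
    by (simp add: b h_powers)
  also have "\<dots> = - (h^3 * (2 * w + 1) * (l^2 + l + 1))"
    using h unfolding xym by algebra
  finally have b': "b = - (h^3 * (2 * w + 1) * (l^2 + l + 1))" .
  define n where "n = hesse_involution l"
  have n: "n * (l - 1) = l + 2"
    using \<open>l \<noteq> 1\<close> by (simp add: n_def hesse_involution_def)
  have "a = h * (2 * w + 1) * (l + 2)"
    using h unfolding a xym by algebra
  then have "a = n * u"
    using n unfolding u_def by algebra
  then have a_eq: "a / u = n"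
    using u by simp
  have N: "(n^3 - 1) * (l - 1)^3 = 9 * (l^2 + l + 1)"
    using n by algebra
  have "u^3 * (h^3 * (n^3 - 1)) = h^6 * (2 * w + 1)^3 * ((n^3 - 1) * (l - 1)^3)"
    unfolding u_def by algebra
  also have "\<dots> = - (27 * h^6 * (2 * w + 1) * (l^2 + l + 1))"
    using w unfolding N by algebra
  also have "27 * h^6 = h^3"
    using h by algebra
  also have "- (h^3 * (2 * w + 1) * (l^2 + l + 1)) = b"
    by (rule b'[symmetric])
  finally have b_eq: "b / u^3 = (n^3 - 1) / 27"
    using u by (simp add: h_powers eq_divide_eq divide_eq_eq mult.commute)
  have "change_vars u 0 0 0 (change_vars 1 x m y (hesse_curve l)) = hesse_curve n"
    unfolding ab by (simp add: a_eq b_eq hesse_curve_def)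
  moreover have "(hesse_curve l, change_vars 1 x m y (hesse_curve l)) \<in> curve_iso"
    using l by (simp add: curve_iso_change_vars elliptic_curve_hesse_curve)
  moreover from this have "(change_vars 1 x m y (hesse_curve l),
      change_vars u 0 0 0 (change_vars 1 x m y (hesse_curve l))) \<in> curve_iso"
    using u by (intro curve_iso_change_vars) (auto simp: curve_iso_def)
  ultimately show ?thesis
    unfolding n_def using curve_iso_trans by metis
qed

lemma hesse_curve_iso_cube_eq:
  assumes l: "(l::'a)^3 \<noteq> 1" and eq: "m^3 = l^3"
  shows "(hesse_curve l, hesse_curve m) \<in> curve_iso"
proof -
  \<comment> \<open>This is a cube root of unity, so the scaling turns \<open>l\<close> into
    \<open>m\<close> and fixes the coefficient that depends on \<open>l^3\<close>. For
    \<open>l = 0\<close> also \<open>m = 0\<close>, and the quotient would be 0.\<close>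
  define u where "u = (if l = 0 then 1 else l / m)"
  have u: "u \<noteq> 0" "u^3 = 1" "l / u = m"
    using eq by (auto simp: u_def power_divide)
  then have "change_vars u 0 0 0 (hesse_curve l) = hesse_curve m"
    by (simp add: hesse_curve_def eq)
  then show ?thesis
    using curve_iso_change_vars[of "hesse_curve l" u 0 0 0] l u(1)
    by (simp add: elliptic_curve_hesse_curve)
qed

lemma hesse_curve_iso_iff:
  assumes l: "(l::'a)^3 \<noteq> 1" and m: "m^3 \<noteq> 1"
  shows "(hesse_curve l, hesse_curve m) \<in> curve_iso \<longleftrightarrow> hesse_j l = hesse_j m"
proof
  assume "(hesse_curve l, hesse_curve m) \<in> curve_iso"
  then have "27 * hesse_j l = 27 * hesse_j m"
    unfolding hesse_j_eq_invariants by (rule curve_iso_imp_invariants_eq)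
  then show "hesse_j l = hesse_j m"
    using twenty_seven_neq_0[OF three] by simp
next
  assume "hesse_j l = hesse_j m"
  \<comment> \<open>Here \<open>k\<close> is one of \<open>l\<close>, \<open>w * l\<close>,
    \<open>w^2 * l\<close>: the isomorphism rotates \<open>l\<close> to \<open>k\<close>, applies
    the involution and rotates to \<open>m\<close>.\<close>
  then consider "m^3 = l^3" | k where "k^3 = l^3" "m^3 = (hesse_involution k)^3"
    unfolding hesse_j_eq_iff[OF w three l m]
    using cube_eq_iff[OF w three, of _ l] by metis
  then show "(hesse_curve l, hesse_curve m) \<in> curve_iso"
  proof cases
    case 1
    then show ?thesis
      using l by (rule hesse_curve_iso_cube_eq[rotated])
  next
    case 2
    then have "k^3 \<noteq> 1" "(hesse_involution k)^3 \<noteq> 1"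
      using l m by simp_all
    then show ?thesis
      using l 2 hesse_curve_iso_cube_eq hesse_curve_iso_involution curve_iso_trans by metis
  qed
qed

end

section \<open>From isomorphism classes to values of the Hesse invariant\<close>

lemma card_image_eq_kernel:
  assumes "\<And>x y. x \<in> A \<Longrightarrow> y \<in> A \<Longrightarrow> f x = f y \<longleftrightarrow> g x = g y"
  shows "card (f ` A) = card (g ` A)"
proof -
  have *: "g (inv_into A f (f x)) = g x" if "x \<in> A" for x
    using that assms f_inv_into_f[of "f x" f A] inv_into_into[of "f x" f A] by blast
  \<comment> \<open>The map sends \<open>f x\<close> to \<open>g x\<close> through a chosen
    preimage; equal kernels make it independent of the choice and injective.\<close>
  have "bij_betw (\<lambda>z. g (inv_into A f z)) (f ` A) (g ` A)"
    unfolding bij_betw_def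
    by (auto simp: * assms image_image intro!: inj_onI)
  then show ?thesis
    by (rule bij_betw_same_card)
qed

lemma card_not_cyclic_curve_classes:
  fixes w :: "'a::field"
  assumes w: "w^2 + w + 1 = 0" and three: "(3::'a) \<noteq> 0"
  shows "card {C \<in> (curve_classes :: 'a weierstrass set set).
      \<exists>E\<in>C. \<not> cyclic_group (torsion_group E 3)} = card (hesse_j ` {l :: 'a. l^3 \<noteq> 1})"
proof -
  let ?Y = "{l :: 'a. l^3 \<noteq> 1}"
  let ?f = "\<lambda>l :: 'a. curve_iso `` {hesse_curve l}"
  have f_eq: "?f l = ?f m \<longleftrightarrow> hesse_j l = hesse_j m" if "l \<in> ?Y" "m \<in> ?Y" for l m
    using that by (simp add: eq_equiv_class_iff[OF equiv_curve_iso]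
        elliptic_curve_hesse_curve[OF w three] hesse_curve_iso_iff[OF w three])
  have "{C \<in> (curve_classes :: 'a weierstrass set set).
      \<exists>E\<in>C. \<not> cyclic_group (torsion_group E 3)} = ?f ` ?Y"
  proof (intro equalityI subsetI)
    fix C :: "'a weierstrass set"
    assume "C \<in> {C \<in> curve_classes. \<exists>E\<in>C. \<not> cyclic_group (torsion_group E 3)}"
    then obtain E E0 where E: "E \<in> C" "\<not> cyclic_group (torsion_group E 3)"
      and C: "C = curve_iso `` {E0}"
      by (auto simp: curve_classes_def elim: quotientE)
    then have "(E0, E) \<in> curve_iso" "elliptic_curve E"
      by (auto simp: curve_iso_def)
    moreover obtain l where l: "l^3 \<noteq> 1" "(E, hesse_curve l) \<in> curve_iso"
      using not_cyclic_torsion_imp_hesse_curve[OF three \<open>elliptic_curve E\<close> E(2)] .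
    ultimately have "(E0, hesse_curve l) \<in> curve_iso"
      using curve_iso_trans by blast
    then have "C = ?f l"
      unfolding C by (rule equiv_class_eq[OF equiv_curve_iso])
    then show "C \<in> ?f ` ?Y"
      using l by blast
  next
    fix C assume "C \<in> ?f ` ?Y"
    then obtain l :: 'a where l: "l^3 \<noteq> 1" "C = ?f l"
      by blast
    then have "elliptic_curve (hesse_curve l)"
      by (simp add: elliptic_curve_hesse_curve[OF w three])
    then have "hesse_curve l \<in> C" "C \<in> curve_classes"
      unfolding l(2) curve_classes_def
      by (auto intro!: equiv_class_self[OF equiv_curve_iso] quotientI simp del: Image_singleton_iff)
    then show "C \<in> {C \<in> curve_classes. \<exists>E\<in>C. \<not> cyclic_group (torsion_group E 3)}"
      using not_cyclic_torsion_hesse_curve[OF w three l(1)] by blast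
  qed
  moreover have "card (?f ` ?Y) = card (hesse_j ` ?Y)"
    using f_eq by (rule card_image_eq_kernel)
  ultimately show ?thesis
    by simp
qed

section \<open>Fibres of the Hesse invariant\<close>

text \<open>Reduces the fibre counts to counting distinct nonzero cubes, each of which has three
  cube roots.\<close>

lemma card_cube_in_roots:
  fixes w :: "'a::{field,finite}"
  assumes w: "w^2 + w + 1 = 0" and three: "(3::'a) \<noteq> 0"
    and "finite Z" "0 \<notin> Z"
  shows "card {m :: 'a. m^3 \<in> (\<lambda>z. z^3) ` Z} = 3 * card ((\<lambda>z. z^3) ` Z)"
proof -
  have "{m. m^3 \<in> (\<lambda>z. z^3) ` Z} = (\<Union>c\<in>(\<lambda>z. z^3) ` Z. {m. m^3 = c})"
    by blast
  also have "card \<dots> = (\<Sum>c\<in>(\<lambda>z. z^3) ` Z. card {m. m^3 = c})"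
    by (rule card_UN_disjoint) (use assms in auto)
  also have "\<dots> = (\<Sum>c\<in>(\<lambda>z. z^3) ` Z. 3)"
    using \<open>0 \<notin> Z\<close> by (intro sum.cong refl) (auto intro!: card_cube_roots[OF w three])
  finally show ?thesis
    by simp
qed

context
  fixes w :: "'a::{field,finite}"
  assumes w: "w^2 + w + 1 = 0" and three: "(3::'a) \<noteq> 0"
begin

text \<open>Cubing maps the fibre onto the cubes of \<open>l\<close> and of the involution applied
  to its three rotations. Away from the special values these are four distinct nonzero cubes with
  three roots each.\<close>

lemma card_generic_fibre:
  fixes l :: 'a
  assumes l: "l^3 \<noteq> 1" and special: "hesse_j l \<noteq> 0" "hesse_j l \<noteq> 64"
  shows "card {m. m^3 \<noteq> 1 \<and> hesse_j m = hesse_j l} = 12"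
proof -
  define z where "z k = hesse_involution (w^k * l)" for k :: nat
  have rot: "(w^k * l)^3 = l^3" for k
  proof -
    have "(w^k)^3 = (w^3)^k"
      by (simp add: mult.commute flip: power_mult)
    then show ?thesis
      by (simp add: power_mult_distrib w_cube[OF w three])
  qed
  have j_rot: "hesse_j (w^k * l) = hesse_j l" for k
    by (simp only: hesse_j_def rot)
  have rot_neq_1: "w^k * l \<noteq> 1" for k
    using rot[of k] l by auto
  have z_nz: "z k \<noteq> 0" for k
  proof
    assume "z k = 0"
    then have "w^k * l = - 2"
      using rot_neq_1[of k] by (auto simp: z_def hesse_involution_def eq_neg_iff_add_eq_0)
    then have "l^3 + 8 = 0"
      using rot[of k] by simp
    then show False
      using l special by (simp add: hesse_j_eq_0_iff)
  qed
  have z_cube_neq_1: "(z k)^3 \<noteq> 1" for k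
  proof
    assume "(z k)^3 = 1"
    moreover define v where "v = w^k * l"
    ultimately have "(v - 1)^3 = (v + 2)^3"
      using rot_neq_1[of k] by (simp add: z_def hesse_involution_def power_divide)
    then have "9 * (v^2 + v + 1) = 0"
      by algebra
    then have "v^2 + v + 1 = 0"
      using nine_neq_0[OF three] mult_eq_0_iff by blast
    then have "v^3 = 1"
      by algebra
    then show False
      using l rot[of k] by (simp add: v_def)
  qed
  define Z where "Z = {l, z 0, z 1, z 2}"
  \<comment> \<open>Since \<open>z\<close> has period 3, comparing cyclic neighbours covers all
    three pairs.\<close>
  have neq: "(z k)^3 \<noteq> (z (Suc k))^3" for k
    using hesse_involution_cube_neq_rotated[OF w three, of "w^k * l"] l special
    by (simp add: z_def rot j_rot mult.assoc)
  moreover have "z 3 = z 0"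
    by (simp add: z_def w_cube[OF w three])
  ultimately have "(z 0)^3 \<noteq> (z 1)^3" "(z 1)^3 \<noteq> (z 2)^3" "(z 2)^3 \<noteq> (z 0)^3"
    using neq[of 0] neq[of 1] neq[of 2] by (simp_all add: numeral_2_eq_2 numeral_3_eq_3)
  moreover have "l^3 \<noteq> (z k)^3" for k
    using hesse_involution_cube_neq[OF w three, of "w^k * l"] l special
    by (simp add: z_def rot j_rot)
  ultimately have "card ((\<lambda>z. z^3) ` Z) = 4"
    by (simp add: Z_def)
  moreover have "l \<noteq> 0"
    using special by (auto simp: hesse_j_def)
  then have "0 \<notin> Z"
    using z_nz by (auto simp: Z_def)
  ultimately have "card {m. m^3 \<in> (\<lambda>z. z^3) ` Z} = 12"
    using card_cube_in_roots[OF w three, of Z] by (simp add: Z_def)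
  moreover have "m^3 \<in> (\<lambda>z. z^3) ` Z \<longleftrightarrow> m^3 \<noteq> 1 \<and> hesse_j m = hesse_j l" for m
  proof (cases "m^3 = 1")
    case True
    then show ?thesis
      using l z_cube_neq_1 by (auto simp: Z_def)
  next
    case False
    then show ?thesis
      using hesse_j_eq_iff[OF w three l False] by (auto simp: Z_def z_def)
  qed
  ultimately show ?thesis
    by simp
qed

lemma card_generic:
  "card {l::'a. l^3 \<noteq> 1 \<and> hesse_j l \<notin> {0, 64}} =
    12 * card (hesse_j ` {l::'a. l^3 \<noteq> 1 \<and> hesse_j l \<notin> {0, 64}})"
    (is "card ?S = _")
proof -
  have "card ?S = (\<Sum>c\<in>hesse_j ` ?S. card {l\<in>?S. hesse_j l = c})"
    by (subst card_UN_disjoint[symmetric]) (auto intro: arg_cong[where f = card])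
  also have "\<dots> = (\<Sum>c\<in>hesse_j ` ?S. 12)"
  proof (rule sum.cong)
    fix c assume "c \<in> hesse_j ` ?S"
    then obtain l :: 'a where l: "l^3 \<noteq> 1" "hesse_j l \<noteq> 0" "hesse_j l \<noteq> 64" "c = hesse_j l"
      by auto
    then have "{l\<in>?S. hesse_j l = c} = {m. m^3 \<noteq> 1 \<and> hesse_j m = hesse_j l}"
      by auto
    then show "card {l\<in>?S. hesse_j l = c} = 12"
      using card_generic_fibre l by simp
  qed simp
  finally show ?thesis
    by simp
qed

lemma card_hesse_parameters: "card {l::'a. l^3 \<noteq> 1} + 3 = CARD('a)"
proof -
  have "card {l::'a. l^3 = 1} = 3"
    using card_cube_roots[OF w three, of 1] by simp
  moreover have "card {l::'a. l^3 \<noteq> 1} + card {l::'a. l^3 = 1} = card (UNIV :: 'a set)"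
    by (subst card_Un_disjoint[symmetric]) (auto intro: arg_cong[where f = card])
  ultimately show ?thesis
    by simp
qed

lemma card_special_fibre_0:
  assumes "(2::'a) \<noteq> 0"
  shows "card {l::'a. l^3 \<noteq> 1 \<and> hesse_j l = 0} = 4"
proof -
  have eight: "m + 8 = 0 \<longleftrightarrow> m = (- 2)^3" for m :: 'a
    using eq_neg_iff_add_eq_0[of m 8] by simp
  \<comment> \<open>Hence -8 differs from 1, and the cube roots of -8 are admissible
    parameters.\<close>
  have "1 + 8 \<noteq> (0::'a)"
    using nine_neq_0[OF three] by simp
  then have one: "1 \<noteq> (- 2 :: 'a)^3"
    unfolding eight .
  have "l^3 \<noteq> 1 \<and> hesse_j l = 0 \<longleftrightarrow> l = 0 \<or> l^3 = (- 2)^3" for l :: 'a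
  proof (cases "l^3 = 1")
    case True
    then have "l \<noteq> 0"
      by auto
    then show ?thesis
      unfolding True using one by blast
  next
    case False
    then show ?thesis
      unfolding hesse_j_eq_0_iff[OF False] mult_eq_0_iff eight by blast
  qed
  then have "{l::'a. l^3 \<noteq> 1 \<and> hesse_j l = 0} = insert 0 {l. l^3 = (- 2)^3}"
    by blast
  moreover have "card {l::'a. l^3 = (- 2)^3} = 3"
    using assms by (intro card_cube_roots[OF w three]) simp
  ultimately show ?thesis
    using assms power_not_zero[of "2::'a" 3] by simp
qed

text \<open>Rotating one solution gives a root \<open>p\<close> of X^2 - 2 X - 2, whose other root
  is \<open>2 - p\<close>. Their cubes are the two roots of L^2 - 20 L - 8, and each has three cube
  roots.\<close>

lemma card_special_fibre_64:
  assumes two: "(2::'a) \<noteq> 0" and l: "(l::'a)^3 \<noteq> 1" "hesse_j l = 64"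
  shows "card {l::'a. l^3 \<noteq> 1 \<and> hesse_j l = 64} = 6"
proof -
  have "l^6 - 20 * l^3 - 8 = (l^2 - 2 * l - 2) * ((w * l)^2 - 2 * (w * l) - 2) *
      ((w^2 * l)^2 - 2 * (w^2 * l) - 2)"
    using w by algebra
  then obtain p :: 'a where p: "p^2 - 2 * p - 2 = 0"
    using l hesse_j_eq_64_iff[OF l(1)] by (metis mult_eq_0_iff)
  have p3: "p^3 = 6 * p + 4" "(2 - p)^3 = 16 - 6 * p"
    using p by algebra+
  have p_nz: "p \<noteq> 0" "2 - p \<noteq> 0"
    using p two by (auto simp: power2_eq_square)
  have "p^3 \<noteq> (2 - p)^3"
  proof
    assume "p^3 = (2 - p)^3"
    then have "2 * 2 * 3 * (p - 1) = 0"
      unfolding p3 by algebra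
    then have "p = 1"
      using two three by (metis mult_eq_0_iff right_minus_eq)
    then show False
      using p three by simp
  qed
  then have "card ((\<lambda>z. z^3) ` {p, 2 - p}) = 2"
    by simp
  then have "card {m. m^3 \<in> (\<lambda>z. z^3) ` {p, 2 - p}} = 6"
    using card_cube_in_roots[OF w three, of "{p, 2 - p}"] p_nz by simp
  moreover have "m^3 \<in> (\<lambda>z. z^3) ` {p, 2 - p} \<longleftrightarrow> m^3 \<noteq> 1 \<and> hesse_j m = 64" for m
  proof -
    have "m^6 - 20 * m^3 - 8 = (m^3 - p^3) * (m^3 - (2 - p)^3)"
      unfolding p3 using p by algebra
    moreover have "m^6 - 20 * m^3 - 8 \<noteq> 0" if "m^3 = 1"
    proof -
      have "m^6 - 20 * m^3 - 8 = - (3 * 3 * 3)"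
        using that by algebra
      then show ?thesis
        using three by (metis mult_eq_0_iff neg_equal_0_iff_equal)
    qed
    moreover have "m^3 \<in> (\<lambda>z. z^3) ` {p, 2 - p} \<longleftrightarrow> (m^3 - p^3) * (m^3 - (2 - p)^3) = 0"
      by auto
    ultimately show ?thesis
      using hesse_j_eq_64_iff[of m] by metis
  qed
  ultimately show ?thesis
    by simp
qed

text \<open>With \<open>N\<close> generic values, \<open>q\<close> is \<open>12 * N + 4\<close> in
  characteristic 2, with \<open>N + 1\<close> values in all; otherwise it is
  \<open>12 * N + 7\<close> with \<open>N + 1\<close> values or \<open>12 * N + 13\<close> with
  \<open>N + 2\<close>.\<close>

lemma card_hesse_j:
  "12 * card (hesse_j ` {l::'a. l^3 \<noteq> 1}) + CARD('a) mod 12 = CARD('a) + 12"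
proof -
  let ?Y = "{l::'a. l^3 \<noteq> 1}"
  let ?F = "\<lambda>c. {l::'a. l^3 \<noteq> 1 \<and> hesse_j l = c}"
  let ?S = "{l::'a. l^3 \<noteq> 1 \<and> hesse_j l \<notin> {0, 64}}"
  define N where "N = card (hesse_j ` ?S)"
  have S: "card ?S = 12 * N"
    unfolding N_def by (rule card_generic)
  have notin: "0 \<notin> hesse_j ` ?S" "64 \<notin> hesse_j ` ?S"
    by auto
  have zero: "0 \<in> ?F 0"
    by (simp add: hesse_j_def)
  show ?thesis
  proof (cases "(2::'a) = 0")
    case True
    have "(64::'a) = 2 * 32" "(8::'a) = 2 * 4"
      by simp_all
    then have even_0: "(64::'a) = 0" "(8::'a) = 0"
      using True by simp_all
    then have F0: "?F 0 = {0}"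
      by (auto simp: hesse_j_eq_0_iff)
    have Y: "?Y = insert 0 ?S" "0 \<notin> ?S"
      using F0 even_0 by auto
    then have "card ?Y = 12 * N + 1"
      unfolding Y(1) using S by (subst card_insert_disjoint) simp_all
    then have "CARD('a) = 12 * N + 4"
      using card_hesse_parameters by simp
    moreover have "hesse_j ` ?Y = insert 0 (hesse_j ` ?S)"
      unfolding Y(1) using zero by auto
    then have "card (hesse_j ` ?Y) = N + 1"
      using card_insert_disjoint[OF finite notin(1)] by (simp only: N_def)
    moreover from \<open>CARD('a) = 12 * N + 4\<close> have "CARD('a) mod 12 = 4"
      by (simp only: mod_mult_self4) simp
    ultimately show ?thesis
      by linarith
  next
    case False
    then have "(2::'a)^6 \<noteq> 0"
      by (rule power_not_zero)
    then have "(64::'a) \<noteq> 0"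
      by simp
    have Y: "?Y = (?F 0 \<union> ?F 64) \<union> ?S" and disj: "(?F 0 \<union> ?F 64) \<inter> ?S = {}"
      by auto
    have "card ?Y = card (?F 0 \<union> ?F 64) + card ?S"
      unfolding Y by (rule card_Un_disjoint[OF finite finite disj])
    moreover have "card (?F 0 \<union> ?F 64) = card (?F 0) + card (?F 64)"
      using \<open>(64::'a) \<noteq> 0\<close> by (intro card_Un_disjoint) auto
    \<comment> \<open>The 7 consists of the three excluded cube roots of unity and the four
      parameters over 0.\<close>
    ultimately have q: "CARD('a) = 12 * N + 7 + card (?F 64)"
      using card_hesse_parameters card_special_fibre_0[OF False] S by linarith
    have image_F: "hesse_j ` ?F c = {c}" if "l \<in> ?F c" for l c
    proof
      show "{c} \<subseteq> hesse_j ` ?F c"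
        using imageI[OF that, of hesse_j] that by simp
    qed auto
    show ?thesis
    proof (cases "?F 64 = {}")
      case True
      then have "hesse_j ` ?Y = insert 0 (hesse_j ` ?S)"
        unfolding Y by (simp only: image_Un image_F[OF zero]) simp
      then have "card (hesse_j ` ?Y) = N + 1"
        using card_insert_disjoint[OF finite notin(1)] by (simp only: N_def)
      moreover from q True have "CARD('a) = 12 * N + 7"
        by (simp only: card.empty)
      moreover from this have "CARD('a) mod 12 = 7"
        by (simp only: mod_mult_self4) simp
      ultimately show ?thesis
        by linarith
    next
      case nonempty: False
      then obtain l :: 'a where l: "l^3 \<noteq> 1" "hesse_j l = 64"
        by blast
      then have "l \<in> ?F 64"
        by simp
      then have "hesse_j ` ?Y = insert 64 (insert 0 (hesse_j ` ?S))"
        unfolding Y by (simp only: image_Un image_F[OF zero] image_F) simp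
      moreover have "64 \<notin> insert 0 (hesse_j ` ?S)"
        using notin(2) \<open>(64::'a) \<noteq> 0\<close> by blast
      ultimately have c: "card (hesse_j ` ?Y) = N + 2"
        using card_insert_disjoint[OF finite \<open>64 \<notin> insert 0 (hesse_j ` ?S)\<close>]
          card_insert_disjoint[OF finite notin(1)]
        by (simp only: N_def)
      have q1: "CARD('a) = 12 * (N + 1) + 1"
        unfolding q card_special_fibre_64[OF False l] by simp
      show ?thesis
        unfolding c q1 mod_mult_self4 by simp
    qed
  qed
qed

end

theorem proposition9:
  fixes q :: nat
  assumes "q = CARD('a::{field,finite})"
    and "q mod 3 = 1"
  shows "real (card {C \<in> (curve_classes :: 'a weierstrass set set).
                       \<exists>E\<in>C. \<not> cyclic_group (torsion_group E 3)})
       = (real q + 12 - real (q mod 12)) / 12"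
proof -
  obtain w :: 'a where w: "w^2 + w + 1 = 0" and three: "(3::'a) \<noteq> 0"
    using finite_field_primitive_cube_root assms by metis
  have "12 * card (hesse_j ` {l :: 'a. l^3 \<noteq> 1}) + q mod 12 = q + 12"
    unfolding assms(1) by (rule card_hesse_j[OF w three])
  moreover have "real c = (real q + 12 - real r) / 12" if "12 * c + r = q + 12" for c r
    using arg_cong[OF that, of real] by simp
  ultimately show ?thesis
    unfolding card_not_cyclic_curve_classes[OF w three] by blast
qed

end
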